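(* (Displacement group.) On $\mathbb R^3$ with coordinates $(\theta,x,y)$, let $\beta,g,a,z,V,\pi,L,\Gamma_1,\Gamma_1^z,\Gamma_2,\Gamma_2^{z,\pi},Q,P,X$ be as in the context. For every smooth $f$, $$\Gamma_2(f,f)+\Gamma_2^{z,\pi}(f,f)=\|\mathfrak{Hess}_{a,z}f\|^2+\mathfrak R(\nabla f,\nabla f),$$ where $\|\mathfrak{Hess}_{a,z}f\|^2=[X+\Lambda_1]^{\mathsf T}Q^{\mathsf T}Q[X+\Lambda_1]+[X+\Lambda_2]^{\mathsf T}P^{\mathsf T}P[X+\Lambda_2]$ with $$\Lambda_1^{\mathsf T}=\big(0,\beta\partial_xf,\tfrac{\beta\partial_yf}2,\beta\partial_xf,0,0,\tfrac{\beta\partial_yf}2,0,-\beta\partial_\theta f\big),\qquad\Lambda_2^{\mathsf T}=(0,0,0,0,0,0,\lambda_6,0,\lambda_9),$$ $$\lambda_6=\tfrac{\partial_\theta g\,\partial_yf}g-\tfrac{\beta(a^{\mathsf T}\nabla)_2f}{g^2}-\tfrac{\partial_\theta g\,\partial_yf}g,\qquad\lambda_9=\tfrac{(a^{\mathsf T}\nabla)_2g\,\partial_yf}g+\tfrac{\beta\partial_\theta f}{g^2}-\tfrac{(a^{\mathsf T}\nabla)_2g\,\partial_yf}g,$$ and $\mathfrak R(\nabla f,\nabla f)=\mathfrak R_1+\mathfrak R_2+\mathfrak R_3$ with $$\begin{aligned}\mathfrak R_1=\;&\Gamma_1(\log g,\log g)\Gamma_1^z(f,f)-\beta^2\big(1+\tfrac1{g^2}\big)\Gamma_1(f,f)+\tfrac{\beta^2}{2g^2}\Gamma_1^z(f,f)+\beta^2e^{\beta\theta}\partial_xf\,(a^{\mathsf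 T}\nabla)_2f\\&+\beta e^{\beta\theta}(a^{\mathsf T}\nabla)_2V\,\partial_xf\,(a^{\mathsf T}\nabla)_1f+\beta e^{\beta\theta}V_x\,(a^{\mathsf T}\nabla)_2f\,(a^{\mathsf T}\nabla)_1f+V_{\theta\theta}|(a^{\mathsf T}\nabla)_1f|^2\\&+2\big(e^{\beta\theta}V_{\theta x}+V_{\theta y}\big)(a^{\mathsf T}\nabla)_1f\,(a^{\mathsf T}\nabla)_2f+\big[e^{2\beta\theta}V_{xx}+2e^{\beta\theta}V_{xy}+V_{yy}\big]|(a^{\mathsf T}\nabla)_2f|^2\\&-\beta e^{\beta\theta}(a^{\mathsf T}\nabla)_1V\,\partial_xf\,(a^{\mathsf T}\nabla)_2f,\end{aligned}$$ $$\begin{aligned}\mathfrak R_2=\;&\big[g_{\theta\theta}+e^{2\beta\theta}g_{xx}+g_{yy}+2e^{\beta\theta}g_{xy}\big]\tfrac{|(z^{\mathsf T}\nabla)_1f|^2}g+\sum_{k=1}^2(a^{\mathsf T}\nabla)_kg\,(a^{\mathsf T}\nabla)_kV\,\partial_yf\,(z^{\mathsf T}\nabla)_1f\\&-gV_{\theta y}(a^{\mathsf T}\nabla)_1f\,(z^{\mathsf T}\nabla)_1f-g\big(e^{\beta\theta}V_{xy}+V_{yy}\big)(a^{\mathsf T}\nabla)_2f\,(z^{\mathsf T}\nabla)_1f,\end{aligned}$$ $$\mathfrak R_3=-2\big[g_{\theta\theta}+e^{2\beta\theta}g_{xx}+g_{yy}+2e^{\beta\theta}g_{xy}\big]\tfrac{|(z^{\mathsf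 T}\nabla)_1f|^2}g-2\Gamma_1(\log\pi,\log g)|(z^{\mathsf T}\nabla)_1f|^2-2\Gamma_1(\log g,\log g)|(z^{\mathsf T}\nabla)_1f|^2 .$$
   Context: Coordinates $(x_1,x_2,x_3)=(\theta,x,y)$ on $\mathbb R^3$ (local coordinates of the displacement group), $\beta\ne0$ a real parameter ($\beta\ge0$), $g=g(\theta,x,y)$ a smooth nowhere vanishing function, with the convention $\nabla\log g=\nabla g/g$. $$a^{\mathsf T}=\begin{pmatrix}1&0&0\\0&e^{\beta\theta}&1\end{pmatrix},\qquad z^{\mathsf T}=(0,0,-g).$$ $V\in C^\infty(\mathbb R^3)$, $\pi=\frac1{\mathcal Z}e^{-V}$ ($\mathcal Z$ a normalizing constant), $b=-aa^{\mathsf T}\nabla V$. $(a^{\mathsf T}\nabla)_1f=\partial_\theta f$, $(a^{\mathsf T}\nabla)_2f=e^{\beta\theta}\partial_xf+\partial_yf$, $(z^{\mathsf T}\nabla)_1f=-g\,\partial_yf$. Subscripts on $V,g$ denote partial derivatives. $Lf=\nabla\cdot(aa^{\mathsf T}\nabla f)-\langle a\otimes\nabla a,\nabla f\rangle+\langle b,\nabla f\rangle$ with $(a\otimes\nabla a)_p=\sum_k\sum_qa_{pk}\partial_{x_q}a_{qk}$ (which vanishes here). $\Gamma_1(f,h)=\langle a^{\mathsf T}\nabla f,a^{\mathsf T}\nabla h\rangle$, $\Gamma_1^z(f,h)=\langle z^{\mathsf T}\nabla f,z^{\mathsf T}\nabla h\rangle$, $\Gamma_2(f,f)=\frac12L\Gamma_1(f,f)-\Gamma_1(Lf,f)$,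 and $$\Gamma_2^{z,\pi}(f,f)=\tfrac12L\Gamma_1^z(f,f)-\Gamma_1^z(Lf,f)+\tfrac1\pi\nabla\cdot\big(\pi zz^{\mathsf T}w\big)-\tfrac1\pi\nabla\cdot\big(\pi aa^{\mathsf T}\tilde w\big),$$ where $w_p=\langle\nabla f,\partial_{x_p}(aa^{\mathsf T})\nabla f\rangle$, $\tilde w_p=\langle\nabla f,\partial_{x_p}(zz^{\mathsf T})\nabla f\rangle$. $X=(f_{11},f_{12},f_{13},f_{21},f_{22},f_{23},f_{31},f_{32},f_{33})^{\mathsf T}$ is the vectorized Hessian, and $$Q=\begin{pmatrix}1&0&0&0&0&0&0&0&0\\0&e^{\beta\theta}&1&0&0&0&0&0&0\\0&0&0&e^{\beta\theta}&0&0&1&0&0\\0&0&0&0&e^{2\beta\theta}&e^{\beta\theta}&0&e^{\beta\theta}&1\end{pmatrix},\qquad P=\begin{pmatrix}0&0&0&0&0&0&-g&0&0\\0&0&0&0&0&0&0&-ge^{\beta\theta}&-g\end{pmatrix}.$$ *)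

theory Defs
  imports "HOL-Analysis.Analysis"
begin

section \<open>Calculus on coordinate space\<close>

text \<open>\<open>C_k k f\<close>: the function \<open>f\<close> is \<open>k\<close> times continuously differentiable on the whole space,
  by recursion through its directional derivatives.\<close>

primrec C_k :: "nat \<Rightarrow> ('a::euclidean_space \<Rightarrow> 'b::real_normed_vector) \<Rightarrow> bool" where
  "C_k 0 f \<longleftrightarrow> continuous_on UNIV f"
| "C_k (Suc k) f \<longleftrightarrow>
     (\<forall>x. f differentiable (at x)) \<and> (\<forall>v. C_k k (\<lambda>x. frechet_derivative f (at x) v))"

definition smooth :: "('a::euclidean_space \<Rightarrow> 'b::real_normed_vector) \<Rightarrow> bool" where
  "smooth f \<longleftrightarrow> (\<forall>k. C_k k f)"

definition pd :: "'n::finite \<Rightarrow> (real^'n \<Rightarrow> real) \<Rightarrow> real^'n \<Rightarrow> real" where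
  "pd i f x = frechet_derivative f (at x) (axis i 1)"

definition grad :: "(real^'n::finite \<Rightarrow> real) \<Rightarrow> real^'n \<Rightarrow> real^'n" where
  "grad f x = (\<chi> i. pd i f x)"

text \<open>The gradient of \<open>log u\<close>, by the convention \<open>\<nabla> log u = \<nabla>u / u\<close>, which makes sense for every
  nowhere vanishing \<open>u\<close> regardless of its sign.\<close>

definition grad_log :: "(real^'n::finite \<Rightarrow> real) \<Rightarrow> real^'n \<Rightarrow> real^'n" where
  "grad_log u x = (1 / u x) *\<^sub>R grad u x"

definition dvg :: "(real^'n::finite \<Rightarrow> real^'n) \<Rightarrow> real^'n \<Rightarrow> real" where
  "dvg w x = (\<Sum>i\<in>UNIV. pd i (\<lambda>y. w y $ i) x)"

definition pd_matrix ::
  "'n::finite \<Rightarrow> (real^'n \<Rightarrow> real^'m::finite^'l::finite) \<Rightarrow> real^'n \<Rightarrow> real^'m^'l" where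
  "pd_matrix p M x = (\<chi> i j. pd p (\<lambda>y. M y $ i $ j) x)"


section \<open>Generator and Gamma operators\<close>

text \<open>A coefficient matrix with \<open>n\<close> rows and \<open>m\<close> columns, depending on the point, has type
  \<open>real^'n \<Rightarrow> real^'m^'n\<close>; its columns are vector fields. The functions below are used both for the
  matrix \<open>a\<close> of the diffusion and for the matrix \<open>z\<close> of the complementary direction.\<close>

definition gram :: "(real^'n::finite \<Rightarrow> real^'m::finite^'n) \<Rightarrow> real^'n \<Rightarrow> real^'n^'n" where
  "gram a x = a x ** transpose (a x)"

text \<open>\<open>tgrad a f x $ k\<close> is \<open>(a\<^sup>T \<nabla>)\<^sub>k f\<close> at \<open>x\<close>.\<close>

definition tgrad ::
  "(real^'n::finite \<Rightarrow> real^'m::finite^'n) \<Rightarrow> (real^'n \<Rightarrow> real) \<Rightarrow> real^'n \<Rightarrow> real^'m" where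
  "tgrad a f x = transpose (a x) *v grad f x"

text \<open>The form \<open>\<langle>a\<^sup>T u, a\<^sup>T v\<rangle>\<close> on vectors is kept separate so that it also applies to gradients of
  logarithms in the sense of \<open>grad_log\<close>.\<close>

definition Gamma_form ::
  "(real^'n::finite \<Rightarrow> real^'m::finite^'n) \<Rightarrow> real^'n \<Rightarrow> real^'n \<Rightarrow> real^'n \<Rightarrow> real" where
  "Gamma_form a x u v = (transpose (a x) *v u) \<bullet> (transpose (a x) *v v)"

definition Gamma1 ::
  "(real^'n::finite \<Rightarrow> real^'m::finite^'n) \<Rightarrow> (real^'n \<Rightarrow> real) \<Rightarrow> (real^'n \<Rightarrow> real) \<Rightarrow> real^'n \<Rightarrow> real"
where
  "Gamma1 a f h x = Gamma_form a x (grad f x) (grad h x)"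

definition a_tensor_grad_a ::
  "(real^'n::finite \<Rightarrow> real^'m::finite^'n) \<Rightarrow> real^'n \<Rightarrow> real^'n" where
  "a_tensor_grad_a a x =
     (\<chi> p. \<Sum>k\<in>UNIV. \<Sum>q\<in>UNIV. a x $ p $ k * pd q (\<lambda>y. a y $ q $ k) x)"

definition drift ::
  "(real^'n::finite \<Rightarrow> real^'m::finite^'n) \<Rightarrow> (real^'n \<Rightarrow> real) \<Rightarrow> real^'n \<Rightarrow> real^'n" where
  "drift a V x = - (gram a x *v grad V x)"

definition gen ::
  "(real^'n::finite \<Rightarrow> real^'m::finite^'n) \<Rightarrow> (real^'n \<Rightarrow> real^'n) \<Rightarrow>
   (real^'n \<Rightarrow> real) \<Rightarrow> real^'n \<Rightarrow> real" where
  "gen a b f x = dvg (\<lambda>y. gram a y *v grad f y) x - a_tensor_grad_a a x \<bullet> grad f x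
     + b x \<bullet> grad f x"

definition Gamma2 ::
  "(real^'n::finite \<Rightarrow> real^'m::finite^'n) \<Rightarrow> (real^'n \<Rightarrow> real^'n) \<Rightarrow>
   (real^'n \<Rightarrow> real) \<Rightarrow> real^'n \<Rightarrow> real" where
  "Gamma2 a b f x = 1/2 * gen a b (Gamma1 a f f) x - Gamma1 a (gen a b f) f x"

text \<open>The vector field \<open>p \<mapsto> \<langle>\<nabla>f, (\<partial>\<^sub>p (c c\<^sup>T)) \<nabla>f\<rangle>\<close>.\<close>

definition gram_variation ::
  "(real^'n::finite \<Rightarrow> real^'m::finite^'n) \<Rightarrow> (real^'n \<Rightarrow> real) \<Rightarrow> real^'n \<Rightarrow> real^'n" where
  "gram_variation c f x = (\<chi> p. grad f x \<bullet> (pd_matrix p (gram c) x *v grad f x))"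

definition Gamma2_z_pi ::
  "(real^'n::finite \<Rightarrow> real^'m::finite^'n) \<Rightarrow> (real^'n \<Rightarrow> real^'l::finite^'n) \<Rightarrow>
   (real^'n \<Rightarrow> real^'n) \<Rightarrow> (real^'n \<Rightarrow> real) \<Rightarrow> (real^'n \<Rightarrow> real) \<Rightarrow> real^'n \<Rightarrow> real" where
  "Gamma2_z_pi a z b \<pi> f x =
     1/2 * gen a b (Gamma1 z f f) x - Gamma1 z (gen a b f) f x
     + 1 / \<pi> x * dvg (\<lambda>y. \<pi> y *\<^sub>R (gram z y *v gram_variation a f y)) x
     - 1 / \<pi> x * dvg (\<lambda>y. \<pi> y *\<^sub>R (gram a y *v gram_variation z f y)) x"


section \<open>The displacement group\<close>

text \<open>Coordinates \<open>(\<theta>, x, y)\<close> are the components \<open>1, 2, 3\<close> of a point of \<open>real^3\<close>.\<close>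

definition disp_a :: "real \<Rightarrow> real^3 \<Rightarrow> real^2^3" where
  "disp_a \<beta> x = transpose (vector [
     vector [1, 0, 0],
     vector [0, exp (\<beta> * x $ 1), 1]])"

definition disp_z :: "(real^3 \<Rightarrow> real) \<Rightarrow> real^3 \<Rightarrow> real^1^3" where
  "disp_z g x = transpose (vector [vector [0, 0, - g x]])"

definition gibbs :: "real \<Rightarrow> (real^3 \<Rightarrow> real) \<Rightarrow> real^3 \<Rightarrow> real" where
  "gibbs Z V x = 1 / Z * exp (- V x)"

definition disp_X :: "(real^3 \<Rightarrow> real) \<Rightarrow> real^3 \<Rightarrow> real^9" where
  "disp_X f x = vector [
     pd 1 (pd 1 f) x, pd 1 (pd 2 f) x, pd 1 (pd 3 f) x,
     pd 2 (pd 1 f) x, pd 2 (pd 2 f) x, pd 2 (pd 3 f) x,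
     pd 3 (pd 1 f) x, pd 3 (pd 2 f) x, pd 3 (pd 3 f) x]"

definition disp_Q :: "real \<Rightarrow> real^3 \<Rightarrow> real^9^4" where
  "disp_Q \<beta> x = (let e = exp (\<beta> * x $ 1); e2 = exp (2 * \<beta> * x $ 1) in vector [
     vector [1, 0, 0, 0, 0,  0, 0, 0, 0],
     vector [0, e, 1, 0, 0,  0, 0, 0, 0],
     vector [0, 0, 0, e, 0,  0, 1, 0, 0],
     vector [0, 0, 0, 0, e2, e, 0, e, 1]])"

definition disp_P :: "real \<Rightarrow> (real^3 \<Rightarrow> real) \<Rightarrow> real^3 \<Rightarrow> real^9^2" where
  "disp_P \<beta> g x = (let e = exp (\<beta> * x $ 1) in vector [
     vector [0, 0, 0, 0, 0, 0, - g x, 0,         0],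
     vector [0, 0, 0, 0, 0, 0, 0,     - g x * e, - g x]])"

definition disp_Lambda1 :: "real \<Rightarrow> (real^3 \<Rightarrow> real) \<Rightarrow> real^3 \<Rightarrow> real^9" where
  "disp_Lambda1 \<beta> f x = vector [
     0, \<beta> * pd 2 f x, \<beta> * pd 3 f x / 2,
     \<beta> * pd 2 f x, 0, 0,
     \<beta> * pd 3 f x / 2, 0, - \<beta> * pd 1 f x]"

definition disp_lambda6 ::
  "real \<Rightarrow> (real^3 \<Rightarrow> real) \<Rightarrow> (real^3 \<Rightarrow> real) \<Rightarrow> real^3 \<Rightarrow> real" where
  "disp_lambda6 \<beta> g f x =
     pd 1 g x * pd 3 f x / g x
     - \<beta> * tgrad (disp_a \<beta>) f x $ 2 / (g x)^2
     - pd 1 g x * pd 3 f x / g x"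

definition disp_lambda9 ::
  "real \<Rightarrow> (real^3 \<Rightarrow> real) \<Rightarrow> (real^3 \<Rightarrow> real) \<Rightarrow> real^3 \<Rightarrow> real" where
  "disp_lambda9 \<beta> g f x =
     tgrad (disp_a \<beta>) g x $ 2 * pd 3 f x / g x
     + \<beta> * pd 1 f x / (g x)^2
     - tgrad (disp_a \<beta>) g x $ 2 * pd 3 f x / g x"

definition disp_Lambda2 ::
  "real \<Rightarrow> (real^3 \<Rightarrow> real) \<Rightarrow> (real^3 \<Rightarrow> real) \<Rightarrow> real^3 \<Rightarrow> real^9" where
  "disp_Lambda2 \<beta> g f x = vector [
     0, 0, 0, 0, 0, 0, disp_lambda6 \<beta> g f x, 0, disp_lambda9 \<beta> g f x]"

definition disp_Hess_sq ::
  "real \<Rightarrow> (real^3 \<Rightarrow> real) \<Rightarrow> (real^3 \<Rightarrow> real) \<Rightarrow> real^3 \<Rightarrow> real" where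
  "disp_Hess_sq \<beta> g f x =
    (let Y1 = disp_X f x + disp_Lambda1 \<beta> f x;
         Y2 = disp_X f x + disp_Lambda2 \<beta> g f x;
         Q = disp_Q \<beta> x;
         P = disp_P \<beta> g x
     in Y1 \<bullet> ((transpose Q ** Q) *v Y1) + Y2 \<bullet> ((transpose P ** P) *v Y2))"

definition disp_R1 ::
  "real \<Rightarrow> (real^3 \<Rightarrow> real) \<Rightarrow> (real^3 \<Rightarrow> real) \<Rightarrow> (real^3 \<Rightarrow> real) \<Rightarrow> real^3 \<Rightarrow> real" where
  "disp_R1 \<beta> g V f x =
    (let a = disp_a \<beta>; z = disp_z g;
         e = exp (\<beta> * x $ 1); e2 = exp (2 * \<beta> * x $ 1);
         a1f = tgrad a f x $ 1; a2f = tgrad a f x $ 2;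
         a1V = tgrad a V x $ 1; a2V = tgrad a V x $ 2
     in Gamma_form a x (grad_log g x) (grad_log g x) * Gamma1 z f f x
        - \<beta>^2 * (1 + 1 / (g x)^2) * Gamma1 a f f x
        + \<beta>^2 / (2 * (g x)^2) * Gamma1 z f f x
        + \<beta>^2 * e * pd 2 f x * a2f
        + \<beta> * e * a2V * pd 2 f x * a1f
        + \<beta> * e * pd 2 V x * a2f * a1f
        + pd 1 (pd 1 V) x * \<bar>a1f\<bar>^2
        + 2 * (e * pd 1 (pd 2 V) x + pd 1 (pd 3 V) x) * a1f * a2f
        + (e2 * pd 2 (pd 2 V) x + 2 * e * pd 2 (pd 3 V) x + pd 3 (pd 3 V) x) * \<bar>a2f\<bar>^2
        - \<beta> * e * a1V * pd 2 f x * a2f)"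

definition disp_R2 ::
  "real \<Rightarrow> (real^3 \<Rightarrow> real) \<Rightarrow> (real^3 \<Rightarrow> real) \<Rightarrow> (real^3 \<Rightarrow> real) \<Rightarrow> real^3 \<Rightarrow> real" where
  "disp_R2 \<beta> g V f x =
    (let a = disp_a \<beta>; z = disp_z g;
         e = exp (\<beta> * x $ 1); e2 = exp (2 * \<beta> * x $ 1);
         a1f = tgrad a f x $ 1; a2f = tgrad a f x $ 2; z1f = tgrad z f x $ 1
     in (pd 1 (pd 1 g) x + e2 * pd 2 (pd 2 g) x + pd 3 (pd 3 g) x + 2 * e * pd 2 (pd 3 g) x)
          * (\<bar>z1f\<bar>^2 / g x)
        + (\<Sum>k\<in>UNIV. tgrad a g x $ k * tgrad a V x $ k * pd 3 f x * z1f)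
        - g x * pd 1 (pd 3 V) x * a1f * z1f
        - g x * (e * pd 2 (pd 3 V) x + pd 3 (pd 3 V) x) * a2f * z1f)"

definition disp_R3 ::
  "real \<Rightarrow> (real^3 \<Rightarrow> real) \<Rightarrow> (real^3 \<Rightarrow> real) \<Rightarrow> (real^3 \<Rightarrow> real) \<Rightarrow> real^3 \<Rightarrow> real" where
  "disp_R3 \<beta> g \<pi> f x =
    (let a = disp_a \<beta>; z = disp_z g;
         e = exp (\<beta> * x $ 1); e2 = exp (2 * \<beta> * x $ 1);
         z1f = tgrad z f x $ 1
     in - 2 * (pd 1 (pd 1 g) x + e2 * pd 2 (pd 2 g) x + pd 3 (pd 3 g) x + 2 * e * pd 2 (pd 3 g) x)
          * (\<bar>z1f\<bar>^2 / g x)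
        - 2 * Gamma_form a x (grad_log \<pi> x) (grad_log g x) * \<bar>z1f\<bar>^2
        - 2 * Gamma_form a x (grad_log g x) (grad_log g x) * \<bar>z1f\<bar>^2)"

definition disp_R ::
  "real \<Rightarrow> (real^3 \<Rightarrow> real) \<Rightarrow> (real^3 \<Rightarrow> real) \<Rightarrow> (real^3 \<Rightarrow> real) \<Rightarrow> (real^3 \<Rightarrow> real) \<Rightarrow> real^3 \<Rightarrow> real"
where
  "disp_R \<beta> g V \<pi> f x = disp_R1 \<beta> g V f x + disp_R2 \<beta> g V f x + disp_R3 \<beta> g \<pi> f x"

end

theory Submission
  imports Defs
begin

text \<open>
  Write \<open>X = \<partial>\<^sub>\<theta>\<close> and \<open>Y = e\<^bsup>\<beta>\<theta>\<^esup> \<partial>\<^sub>x + \<partial>\<^sub>y\<close>. Both fields are divergence free, so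
  \<open>L u = XXu + YYu - XV Xu - YV Yu\<close>, and since \<open>[X, Y] = \<beta> e\<^bsup>\<beta>\<theta>\<^esup> \<partial>\<^sub>x\<close>, the third derivatives of
  \<open>f\<close> cancel in \<open>\<Gamma>\<^sub>2\<close> and only \<open>[L, X]f\<close> and \<open>[L, Y]f\<close> survive. In \<open>\<Gamma>\<^sub>2\<^sup>z\<^sup>,\<^sup>\<pi>\<close> the first
  divergence term vanishes, because \<open>a a\<^sup>T\<close> depends on \<open>\<theta>\<close> only while \<open>z z\<^sup>T\<close> acts on the \<open>y\<close>
  component only; the second one cancels all mixed products of derivatives of \<open>g\<close> with the
  Hessian of \<open>f\<close>. The shifts \<open>\<Lambda>\<^sub>1\<close> and \<open>\<Lambda>\<^sub>2\<close> then absorb the terms linear in the Hessian,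
  and completing the squares for \<open>\<Lambda>\<^sub>2\<close> produces the terms in \<open>1 / g\<^sup>2\<close>.
\<close>

section \<open>Smooth functions\<close>

lemma C_k_Suc_imp: "C_k (Suc k) f \<Longrightarrow> C_k k f"
proof (induction k arbitrary: f)
  case 0
  then show ?case
    by (auto intro!: differentiable_imp_continuous_on simp: differentiable_on_def
        intro: differentiable_at_withinI)
qed auto

lemma C_k_const: "C_k k (\<lambda>x. c)"
  by (induction k arbitrary: c) auto

lemma frechet_derivative_eqI:
  "(f has_derivative f') (at x) \<Longrightarrow> frechet_derivative f (at x) v = f' v"
  using frechet_derivative_at by metis

text \<open>Lets a concrete differentiation rule stand in for the abstract
  \<open>frechet_derivative\<close>, so that each closure property below is an induction on the
  order.\<close>

lemma C_k_SucI:
  assumes "\<And>x. (f has_derivative f' x) (at x)" and "\<And>v. C_k k (\<lambda>x. f' x v)"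
  shows "C_k (Suc k) f"
  using assms by (auto simp: frechet_derivative_eqI[OF assms(1)] differentiable_def)

lemma C_k_Suc_has_derivative:
  "C_k (Suc k) f \<Longrightarrow> (f has_derivative frechet_derivative f (at x)) (at x)"
  by (simp flip: frechet_derivative_works)

lemma C_k_add: "C_k k u \<Longrightarrow> C_k k v \<Longrightarrow> C_k k (\<lambda>x. u x + v x)"
proof (induction k arbitrary: u v)
  case (Suc k)
  show ?case
    by (rule C_k_SucI[OF has_derivative_add[OF Suc.prems[THEN C_k_Suc_has_derivative]]])
      (use Suc in auto)
qed (auto intro: continuous_on_add)

lemma C_k_mult:
  fixes u v :: "'a::euclidean_space \<Rightarrow> real"
  shows "C_k k u \<Longrightarrow> C_k k v \<Longrightarrow> C_k k (\<lambda>x. u x * v x)"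
proof (induction k arbitrary: u v)
  case (Suc k)
  \<comment> \<open>The product rule contains the undifferentiated factors, which are therefore
    needed at order \<open>k\<close> as well.\<close>
  show ?case
    by (rule C_k_SucI[OF has_derivative_mult[OF Suc.prems[THEN C_k_Suc_has_derivative]]])
      (use Suc Suc.prems[THEN C_k_Suc_imp] in \<open>auto intro!: C_k_add\<close>)
qed (auto intro: continuous_on_mult)

lemma C_k_exp:
  fixes u :: "'a::euclidean_space \<Rightarrow> real"
  shows "C_k k u \<Longrightarrow> C_k k (\<lambda>x. exp (u x))"
proof (induction k arbitrary: u)
  case (Suc k)
  \<comment> \<open>The derivative contains \<open>exp (u x)\<close> again; at order
    \<open>k\<close> the induction hypothesis covers it.\<close>
  show ?case
    by (rule C_k_SucI[OF has_derivative_exp[OF C_k_Suc_has_derivative[OF Suc.prems]]])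
      (use Suc C_k_Suc_imp[OF Suc.prems] in \<open>auto intro!: C_k_mult\<close>)
qed (auto intro: continuous_on_exp)

lemma smooth_const [simp, intro]: "smooth (\<lambda>x. c)"
  by (simp add: smooth_def C_k_const)

lemma smooth_add [simp, intro]: "smooth u \<Longrightarrow> smooth v \<Longrightarrow> smooth (\<lambda>x. u x + v x)"
  by (simp add: smooth_def C_k_add)

lemma smooth_mult [simp, intro]:
  fixes u v :: "'a::euclidean_space \<Rightarrow> real"
  shows "smooth u \<Longrightarrow> smooth v \<Longrightarrow> smooth (\<lambda>x. u x * v x)"
  by (simp add: smooth_def C_k_mult)

lemma smooth_minus [simp, intro]:
  fixes u :: "'a::euclidean_space \<Rightarrow> real"
  shows "smooth u \<Longrightarrow> smooth (\<lambda>x. - u x)"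
  using smooth_mult[of "\<lambda>_. -1" u] by simp

lemma smooth_diff [simp, intro]:
  fixes u v :: "'a::euclidean_space \<Rightarrow> real"
  shows "smooth u \<Longrightarrow> smooth v \<Longrightarrow> smooth (\<lambda>x. u x - v x)"
  using smooth_add[of u "\<lambda>x. - v x"] by simp

lemma smooth_power [simp, intro]:
  fixes u :: "'a::euclidean_space \<Rightarrow> real"
  shows "smooth u \<Longrightarrow> smooth (\<lambda>x. u x ^ n)"
  by (induction n) auto

lemma smooth_exp [simp, intro]:
  fixes u :: "'a::euclidean_space \<Rightarrow> real"
  shows "smooth u \<Longrightarrow> smooth (\<lambda>x. exp (u x))"
  by (simp add: smooth_def C_k_exp)

lemma smooth_nth [simp, intro]: "smooth (\<lambda>x :: real^'n::finite. x $ i)"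
proof -
  have "C_k k (\<lambda>x :: real^'n. x $ i)" for k
  proof (cases k)
    case 0
    then show ?thesis by (simp add: continuous_on_component)
  next
    case (Suc m)
    have "((\<lambda>x :: real^'n. x $ i) has_derivative (\<lambda>h. h $ i)) (at x)" for x
      by (intro bounded_linear_imp_has_derivative bounded_linear_vec_nth)
    then show ?thesis
      unfolding Suc by (rule C_k_SucI) (rule C_k_const)
  qed
  then show ?thesis by (simp add: smooth_def)
qed

lemma smooth_has_derivative:
  "smooth f \<Longrightarrow> (f has_derivative frechet_derivative f (at x)) (at x)"
  by (rule C_k_Suc_has_derivative) (simp only: smooth_def)

lemma smooth_pd [simp, intro]: "smooth f \<Longrightarrow> smooth (pd i f)"
  unfolding smooth_def pd_def[abs_def] by (metis C_k.simps(2))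


section \<open>Partial derivatives\<close>

lemma pd_eqI: "(f has_derivative f') (at x) \<Longrightarrow> pd i f x = f' (axis i 1)"
  by (simp add: pd_def frechet_derivative_eqI)

lemma pd_const: "pd i (\<lambda>y. c) = (\<lambda>x. 0)"
  by (rule ext) (simp add: pd_def)

lemma pd_add:
  "smooth u \<Longrightarrow> smooth v \<Longrightarrow> pd i (\<lambda>y. u y + v y) = (\<lambda>x. pd i u x + pd i v x)"
  by (rule ext, subst pd_eqI[OF has_derivative_add]) (auto intro: smooth_has_derivative simp: pd_def)

lemma pd_diff:
  "smooth u \<Longrightarrow> smooth v \<Longrightarrow> pd i (\<lambda>y. u y - v y) = (\<lambda>x. pd i u x - pd i v x)"
  by (rule ext, subst pd_eqI[OF has_derivative_diff]) (auto intro: smooth_has_derivative simp: pd_def)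

lemma pd_minus: "smooth u \<Longrightarrow> pd i (\<lambda>y. - u y) = (\<lambda>x. - pd i u x)"
  by (rule ext, subst pd_eqI[OF has_derivative_minus]) (auto intro: smooth_has_derivative simp: pd_def)

lemma pd_mult:
  "smooth u \<Longrightarrow> smooth v \<Longrightarrow> pd i (\<lambda>y. u y * v y) = (\<lambda>x. pd i u x * v x + u x * pd i v x)"
  by (rule ext, subst pd_eqI[OF has_derivative_mult]) (auto intro: smooth_has_derivative simp: pd_def)

lemma pd_exp: "smooth u \<Longrightarrow> pd i (\<lambda>y. exp (u y)) = (\<lambda>x. exp (u x) * pd i u x)"
  by (rule ext, subst pd_eqI[OF has_derivative_exp]) (auto intro: smooth_has_derivative simp: pd_def)

lemma pd_power2: "smooth u \<Longrightarrow> pd i (\<lambda>y. (u y)\<^sup>2) = (\<lambda>x. 2 * u x * pd i u x)"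
  by (auto simp: power2_eq_square pd_mult)

lemma pd_nth: "pd i (\<lambda>y. y $ j) = (\<lambda>x. if i = j then 1 else 0)"
  by (rule ext, subst pd_eqI[OF bounded_linear_imp_has_derivative[OF bounded_linear_vec_nth]])
    (auto simp: axis_def)

text \<open>All rules equate functions rather than values at a point, so they also rewrite under a
  further \<open>pd\<close>.\<close>

lemmas pd_simps = pd_const pd_add pd_diff pd_minus pd_mult pd_exp pd_power2 pd_nth

section \<open>Symmetry of second derivatives\<close>

lemma mean_value_line:
  fixes f :: "'a::euclidean_space \<Rightarrow> real"
  assumes "\<And>x. f differentiable (at x)" and "h > 0"
  obtains s where "0 < s" "s < h"
    "f (x + h *\<^sub>R u) - f x = h * frechet_derivative f (at (x + s *\<^sub>R u)) u"
proof -
  have "((\<lambda>s. f (x + s *\<^sub>R u)) has_real_derivative frechet_derivative f (at (x + s *\<^sub>R u)) u) (at s)"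
    for s
  proof -
    have f: "(f has_derivative frechet_derivative f (at (x + s *\<^sub>R u))) (at (x + s *\<^sub>R u))"
      using assms(1) frechet_derivative_works by blast
    have "((\<lambda>s. f (x + s *\<^sub>R u)) has_derivative
        (\<lambda>r. frechet_derivative f (at (x + s *\<^sub>R u)) (r *\<^sub>R u))) (at s)"
      by (rule has_derivative_compose[where g = f and f = "\<lambda>s. x + s *\<^sub>R u", OF _ f])
        (auto intro!: derivative_eq_intros)
    moreover have "(\<lambda>r. frechet_derivative f (at (x + s *\<^sub>R u)) (r *\<^sub>R u))
        = (*) (frechet_derivative f (at (x + s *\<^sub>R u)) u)"
      using linear_cmul[OF linear_frechet_derivative[OF assms(1)]] by (simp add: fun_eq_iff)
    ultimately show ?thesis
      by (simp add: has_field_derivative_def)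
  qed
  then have "\<exists>s. 0 < s \<and> s < h \<and> f (x + h *\<^sub>R u) - f (x + 0 *\<^sub>R u)
      = (h - 0) * frechet_derivative f (at (x + s *\<^sub>R u)) u"
    by (intro MVT2) (use \<open>h > 0\<close> in auto)
  then show ?thesis using that by auto
qed

text \<open>The second difference is \<open>F (x + h u) - F x\<close> with
  \<open>F y = f (y + h v) - f y\<close>. The mean value theorem along \<open>u\<close> turns it
  into a difference of first derivatives of \<open>f\<close>, and a second application along
  \<open>v\<close> gives \<open>p = x + s u + t v\<close> with \<open>s, t < h\<close>.\<close>

lemma second_difference_mean_value:
  fixes f :: "'a::euclidean_space \<Rightarrow> real"
  assumes "C_k 2 f" and "h > 0"
  obtains p where "norm (p - x) \<le> h * (norm u + norm v)"
    "f (x + h *\<^sub>R u + h *\<^sub>R v) - f (x + h *\<^sub>R u) - f (x + h *\<^sub>R v) + f x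
      = h\<^sup>2 * frechet_derivative (\<lambda>y. frechet_derivative f (at y) u) (at p) v"
proof -
  have f: "f differentiable (at y)" "(\<lambda>y. frechet_derivative f (at y) w) differentiable (at y)" for y w
    using assms(1) by (simp_all add: numeral_2_eq_2)
  define F where "F = (\<lambda>y. f (y + h *\<^sub>R v) - f y)"
  have F: "(F has_derivative (\<lambda>w. frechet_derivative f (at (y + h *\<^sub>R v)) w
      - frechet_derivative f (at y) w)) (at y)" for y
  proof -
    have 1: "(f has_derivative frechet_derivative f (at z)) (at z)" for z
      using f(1) frechet_derivative_works by blast
    have "((\<lambda>y. f (y + h *\<^sub>R v)) has_derivative frechet_derivative f (at (y + h *\<^sub>R v))) (at y)"
      by (rule has_derivative_compose[where g = f and f = "\<lambda>y. y + h *\<^sub>R v", OF _ 1])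
        (auto intro!: derivative_eq_intros)
    from has_derivative_diff[OF this 1] show ?thesis by (simp add: F_def)
  qed
  obtain s where s: "0 < s" "s < h"
    "F (x + h *\<^sub>R u) - F x = h * frechet_derivative F (at (x + s *\<^sub>R u)) u"
    using mean_value_line[of F h x u] F \<open>h > 0\<close> unfolding differentiable_def by blast
  obtain t where t: "0 < t" "t < h"
    "frechet_derivative f (at (x + s *\<^sub>R u + h *\<^sub>R v)) u - frechet_derivative f (at (x + s *\<^sub>R u)) u
     = h * frechet_derivative (\<lambda>y. frechet_derivative f (at y) u) (at (x + s *\<^sub>R u + t *\<^sub>R v)) v"
    using mean_value_line[of "\<lambda>y. frechet_derivative f (at y) u" h "x + s *\<^sub>R u" v] f(2) \<open>h > 0\<close> by blast
  show ?thesis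
  proof
    have "norm (x + s *\<^sub>R u + t *\<^sub>R v - x) \<le> norm (s *\<^sub>R u) + norm (t *\<^sub>R v)"
      using norm_triangle_ineq[of "s *\<^sub>R u" "t *\<^sub>R v"] by (simp add: algebra_simps)
    also have "\<dots> \<le> h * (norm u + norm v)"
      using s t by (simp add: distrib_left add_mono mult_right_mono)
    finally show "norm (x + s *\<^sub>R u + t *\<^sub>R v - x) \<le> h * (norm u + norm v)" .
    have "f (x + h *\<^sub>R u + h *\<^sub>R v) - f (x + h *\<^sub>R u) - f (x + h *\<^sub>R v) + f x = F (x + h *\<^sub>R u) - F x"
      by (simp add: F_def algebra_simps)
    also have "\<dots> = h\<^sup>2 * frechet_derivative (\<lambda>y. frechet_derivative f (at y) u)
        (at (x + s *\<^sub>R u + t *\<^sub>R v)) v"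
      unfolding s(3) frechet_derivative_eqI[OF F] t(3) by (simp add: power2_eq_square)
    finally show "f (x + h *\<^sub>R u + h *\<^sub>R v) - f (x + h *\<^sub>R u) - f (x + h *\<^sub>R v) + f x
      = h\<^sup>2 * frechet_derivative (\<lambda>y. frechet_derivative f (at y) u) (at (x + s *\<^sub>R u + t *\<^sub>R v)) v" .
  qed
qed

text \<open>Schwarz's theorem: the second difference is symmetric in \<open>u\<close> and
  \<open>v\<close>, so the two mixed derivatives agree at points arbitrarily close to
  \<open>x\<close>, and continuity carries the equality to \<open>x\<close>.\<close>

lemma frechet_derivative_commute:
  fixes f :: "'a::euclidean_space \<Rightarrow> real"
  assumes "C_k 2 f"
  shows "frechet_derivative (\<lambda>y. frechet_derivative f (at y) u) (at x) v
    = frechet_derivative (\<lambda>y. frechet_derivative f (at y) v) (at x) u"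
proof -
  define D where "D u v p = frechet_derivative (\<lambda>y. frechet_derivative f (at y) u) (at p) v" for u v p
  have cont: "continuous_on UNIV (D u v)" for u v
    using assms by (simp add: numeral_2_eq_2 D_def[abs_def])
  have "\<exists>p q. norm (p - x) \<le> h * (norm u + norm v) \<and> norm (q - x) \<le> h * (norm u + norm v)
      \<and> D u v p = D v u q" if "h > 0" for h
  proof -
    obtain p where p: "norm (p - x) \<le> h * (norm u + norm v)"
      "f (x + h *\<^sub>R u + h *\<^sub>R v) - f (x + h *\<^sub>R u) - f (x + h *\<^sub>R v) + f x = h\<^sup>2 * D u v p"
      using second_difference_mean_value[OF assms \<open>h > 0\<close>, of x u v] unfolding D_def by blast
    obtain q where q: "norm (q - x) \<le> h * (norm v + norm u)"
      "f (x + h *\<^sub>R v + h *\<^sub>R u) - f (x + h *\<^sub>R v) - f (x + h *\<^sub>R u) + f x = h\<^sup>2 * D v u q"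
      using second_difference_mean_value[OF assms \<open>h > 0\<close>, of x v u] unfolding D_def by blast
    have "h\<^sup>2 * D u v p = h\<^sup>2 * D v u q"
      unfolding p(2)[symmetric] q(2)[symmetric] by (simp add: add.commute add.left_commute)
    with p(1) q(1) \<open>h > 0\<close> show ?thesis
      by (intro exI[of _ p] exI[of _ q]) (simp add: add.commute)
  qed
  \<comment> \<open>Step sizes \<open>h = 1 / (n + 1)\<close> give sequences of such points that
    converge to \<open>x\<close>.\<close>
  then have "\<forall>n. \<exists>p q. norm (p - x) \<le> inverse (real (Suc n)) * (norm u + norm v)
      \<and> norm (q - x) \<le> inverse (real (Suc n)) * (norm u + norm v) \<and> D u v p = D v u q"
    by (intro allI) (simp del: of_nat_Suc)
  from choice[OF this] obtain p where
    "\<forall>n. \<exists>q. norm (p n - x) \<le> inverse (real (Suc n)) * (norm u + norm v)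
      \<and> norm (q - x) \<le> inverse (real (Suc n)) * (norm u + norm v) \<and> D u v (p n) = D v u q" ..
  from choice[OF this] obtain q where
    pq: "\<forall>n. norm (p n - x) \<le> inverse (real (Suc n)) * (norm u + norm v)
      \<and> norm (q n - x) \<le> inverse (real (Suc n)) * (norm u + norm v) \<and> D u v (p n) = D v u (q n)" ..
  then have p: "norm (p n - x) \<le> inverse (real (Suc n)) * (norm u + norm v)"
    and q: "norm (q n - x) \<le> inverse (real (Suc n)) * (norm u + norm v)"
    and eq: "D u v (p n) = D v u (q n)" for n
    by blast+
  have lim: "(\<lambda>n. inverse (real (Suc n)) * (norm u + norm v)) \<longlonglongrightarrow> 0"
    using tendsto_mult_left_zero[OF LIMSEQ_inverse_real_of_nat] by simp
  have "p \<longlonglongrightarrow> x" "q \<longlonglongrightarrow> x"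
    using Lim_null_comparison[OF always_eventually[OF allI[OF p]] lim]
      Lim_null_comparison[OF always_eventually[OF allI[OF q]] lim]
    by (simp_all add: Lim_null[symmetric])
  then have "(\<lambda>n. D u v (p n)) \<longlonglongrightarrow> D u v x" "(\<lambda>n. D v u (q n)) \<longlonglongrightarrow> D v u x"
    using continuous_on_tendsto_compose[OF cont] by simp_all
  then have "D u v x = D v u x"
    unfolding eq by (rule LIMSEQ_unique)
  then show ?thesis by (simp only: D_def)
qed

lemma pd_commute: "smooth f \<Longrightarrow> pd i (pd j f) = pd j (pd i f)"
  unfolding smooth_def pd_def[abs_def] by (rule ext) (rule frechet_derivative_commute, blast)

text \<open>Oriented to a normal form in which indices do not decrease from the outside in, so that
  equal mixed derivatives become the same term.\<close>

lemma pd_commute_3: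
  assumes "smooth u"
  shows "pd 2 (pd 1 u) = pd 1 (pd 2 u)" "pd 3 (pd 1 u) = pd 1 (pd 3 u)" "pd 3 (pd 2 u) = pd 2 (pd 3 u)"
  using assms by (auto intro: pd_commute)


section \<open>Vectors and matrices of small size\<close>

lemma matrix_vector_mult_3: "(A :: real^3^3) *v w =
    vector [A $ 1 $ 1 * w $ 1 + A $ 1 $ 2 * w $ 2 + A $ 1 $ 3 * w $ 3,
      A $ 2 $ 1 * w $ 1 + A $ 2 $ 2 * w $ 2 + A $ 2 $ 3 * w $ 3,
      A $ 3 $ 1 * w $ 1 + A $ 3 $ 2 * w $ 2 + A $ 3 $ 3 * w $ 3]"
  by (simp add: vec_eq_iff forall_3 matrix_vector_mult_def sum_3)

lemma inner_3: "(u :: real^3) \<bullet> w = u $ 1 * w $ 1 + u $ 2 * w $ 2 + u $ 3 * w $ 3"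
  by (simp add: inner_vec_def sum_3)

lemma vector_9 [simp]:
  fixes a1 a2 a3 a4 a5 a6 a7 a8 a9 :: "'a::zero"
  defines "v \<equiv> vector [a1, a2, a3, a4, a5, a6, a7, a8, a9] :: 'a^9"
  shows "v $ 1 = a1" "v $ 2 = a2" "v $ 3 = a3" "v $ 4 = a4" "v $ 5 = a5"
    "v $ 6 = a6" "v $ 7 = a7" "v $ 8 = a8" "v $ 9 = a9"
  unfolding v_def vector_def by simp_all

lemma vector_4 [simp]:
  fixes a1 a2 a3 a4 :: "'a::zero"
  defines "v \<equiv> vector [a1, a2, a3, a4] :: 'a^4"
  shows "v $ 1 = a1" "v $ 2 = a2" "v $ 3 = a3" "v $ 4 = a4"
  unfolding v_def vector_def by simp_all

lemma exhaust_9: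
  fixes x :: 9
  shows "x = 1 \<or> x = 2 \<or> x = 3 \<or> x = 4 \<or> x = 5 \<or> x = 6 \<or> x = 7 \<or> x = 8 \<or> x = 9"
proof (induct x)
  case (of_int z)
  \<comment> \<open>In this type the numeral 9 equals 0, so the residue 0 is the case
    \<open>x = 9\<close>.\<close>
  then have "z = 0 \<or> z = 1 \<or> z = 2 \<or> z = 3 \<or> z = 4 \<or> z = 5 \<or> z = 6 \<or> z = 7 \<or> z = 8" by fastforce
  then show ?case by auto
qed

lemma sum_9: "sum h (UNIV :: 9 set) = h 1 + h 2 + h 3 + h 4 + h 5 + h 6 + h 7 + h 8 + h 9"
proof -
  have UNIV_9: "(UNIV :: 9 set) = {1, 2, 3, 4, 5, 6, 7, 8, 9}"
    using exhaust_9 by auto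
  show ?thesis
    unfolding UNIV_9 by (simp add: ac_simps)
qed

text \<open>Reduces the two quadratic forms of the Hessian norm to sums of squares, without
  multiplying out the 9 by 9 matrices.\<close>

lemma inner_gram_mult: "v \<bullet> ((transpose A ** A) *v v) = (A *v v) \<bullet> (A *v v)" for A :: "real^'n^'m"
  by (simp add: dot_lmul_matrix inner_commute[of v] flip: matrix_vector_mul_assoc)


section \<open>The displacement group\<close>

lemma disp_a_nth:
  "disp_a \<beta> x $ 1 $ 1 = 1" "disp_a \<beta> x $ 1 $ 2 = 0"
  "disp_a \<beta> x $ 2 $ 1 = 0" "disp_a \<beta> x $ 2 $ 2 = exp (\<beta> * x $ 1)"
  "disp_a \<beta> x $ 3 $ 1 = 0" "disp_a \<beta> x $ 3 $ 2 = 1"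
  by (simp_all add: disp_a_def transpose_def)

lemma disp_z_nth: "disp_z g x $ 1 $ 1 = 0" "disp_z g x $ 2 $ 1 = 0" "disp_z g x $ 3 $ 1 = - g x"
  by (simp_all add: disp_z_def transpose_def)

text \<open>Stated with \<open>v*\<close> because the simplifier rewrites
  \<open>transpose A *v w\<close> to this product.\<close>

lemma vector_mult_disp_a:
  "w v* disp_a \<beta> x = vector [w $ 1, exp (\<beta> * x $ 1) * w $ 2 + w $ 3]"
  by (simp add: vec_eq_iff forall_2 vector_matrix_mult_def sum_3 disp_a_nth)

lemma vector_mult_disp_z: "w v* disp_z g x = vector [- g x * w $ 3]"
  by (simp add: vec_eq_iff vector_matrix_mult_def sum_3 disp_z_nth)

text \<open>The square of the exponential is kept instead of
  \<open>exp (2 * \<beta> * x $ 1)\<close>: with a single exponential as an atom, the later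
  identities are polynomial.\<close>

lemma gram_disp_a:
  "gram (disp_a \<beta>) x = vector [
    vector [1, 0, 0],
    vector [0, (exp (\<beta> * x $ 1))\<^sup>2, exp (\<beta> * x $ 1)],
    vector [0, exp (\<beta> * x $ 1), 1]]"
  by (simp add: vec_eq_iff forall_3 gram_def matrix_matrix_mult_def transpose_def sum_2 disp_a_nth
      power2_eq_square)

lemma gram_disp_z:
  "gram (disp_z g) x = vector [vector [0, 0, 0], vector [0, 0, 0], vector [0, 0, (g x)\<^sup>2]]"
  by (simp add: vec_eq_iff forall_3 gram_def matrix_matrix_mult_def transpose_def disp_z_nth
      power2_eq_square)

lemma grad_nth: "grad f x $ i = pd i f x"
  by (simp add: grad_def)

lemma tgrad_disp_a:
  "tgrad (disp_a \<beta>) f x $ 1 = pd 1 f x"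
  "tgrad (disp_a \<beta>) f x $ 2 = exp (\<beta> * x $ 1) * pd 2 f x + pd 3 f x"
  by (simp_all add: tgrad_def vector_mult_disp_a grad_nth)

lemma tgrad_disp_z: "tgrad (disp_z g) f x $ 1 = - g x * pd 3 f x"
  by (simp add: tgrad_def vector_mult_disp_z grad_nth)

lemma Gamma_form_disp_a:
  "Gamma_form (disp_a \<beta>) x u w
   = u $ 1 * w $ 1 + (exp (\<beta> * x $ 1) * u $ 2 + u $ 3) * (exp (\<beta> * x $ 1) * w $ 2 + w $ 3)"
  by (simp add: Gamma_form_def vector_mult_disp_a inner_vec_def sum_2)

lemma Gamma_form_disp_z: "Gamma_form (disp_z g) x u w = (g x)\<^sup>2 * u $ 3 * w $ 3"
  by (simp add: Gamma_form_def vector_mult_disp_z inner_vec_def power2_eq_square)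

lemma Gamma1_disp_a:
  "Gamma1 (disp_a \<beta>) f h = (\<lambda>x. pd 1 f x * pd 1 h x
    + (exp (\<beta> * x $ 1) * pd 2 f x + pd 3 f x) * (exp (\<beta> * x $ 1) * pd 2 h x + pd 3 h x))"
  by (rule ext) (simp add: Gamma1_def Gamma_form_disp_a grad_nth)

lemma Gamma1_disp_z: "Gamma1 (disp_z g) f h = (\<lambda>x. (g x)\<^sup>2 * pd 3 f x * pd 3 h x)"
  by (rule ext) (simp add: Gamma1_def Gamma_form_disp_z grad_nth)

section \<open>Generator and variations of the Gram matrices\<close>

lemma pd_disp_exp:
  "pd i (\<lambda>y :: real^3. exp (\<beta> * y $ 1)) = (\<lambda>x. if i = 1 then \<beta> * exp (\<beta> * x $ 1) else 0)"
  by (auto simp: pd_simps)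

text \<open>The only nonconstant entry depends on \<theta> but lies in the \<open>x\<close> row,
  where it is differentiated in \<open>x\<close>.\<close>

lemma a_tensor_grad_disp_a: "a_tensor_grad_a (disp_a \<beta>) x = 0"
  by (simp add: vec_eq_iff a_tensor_grad_a_def sum_2 sum_3 disp_a_nth pd_const pd_disp_exp)

text \<open>The exponentials are met only by derivatives in \<open>x\<close> and \<open>y\<close>,
  so the divergence yields no first-order terms. An equation of functions is needed because
  \<open>gen\<close> is differentiated inside \<open>Gamma1\<close>.\<close>

lemma gen_disp_a:
  assumes "smooth V" "smooth u"
  shows "gen (disp_a \<beta>) (drift (disp_a \<beta>) V) u = (\<lambda>x. pd 1 (pd 1 u) x
    + (exp (\<beta> * x $ 1))\<^sup>2 * pd 2 (pd 2 u) x + 2 * exp (\<beta> * x $ 1) * pd 2 (pd 3 u) x + pd 3 (pd 3 u) x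
    - pd 1 V x * pd 1 u x
    - (exp (\<beta> * x $ 1) * pd 2 V x + pd 3 V x) * (exp (\<beta> * x $ 1) * pd 2 u x + pd 3 u x))"
  using assms pd_commute[of u 3 2]
  by (auto simp: gen_def dvg_def drift_def a_tensor_grad_disp_a gram_disp_a
      matrix_vector_mult_3 inner_3 sum_3 grad_nth pd_simps algebra_simps power2_eq_square)

lemma gram_variation_disp_a:
  "gram_variation (disp_a \<beta>) f x = vector [2 * \<beta> * exp (\<beta> * x $ 1) * pd 2 f x
     * (exp (\<beta> * x $ 1) * pd 2 f x + pd 3 f x), 0, 0]"
  by (simp add: vec_eq_iff forall_3 gram_variation_def pd_matrix_def gram_disp_a
      matrix_vector_mult_3 inner_3 grad_nth pd_simps power2_eq_square algebra_simps)

text \<open>The single nonzero entry of the Gram matrix is \<open>g^2\<close>, so the field is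
  \<open>(pd 3 f)^2\<close> times the gradient of \<open>g^2\<close>.\<close>

lemma gram_variation_disp_z:
  assumes "smooth g"
  shows "gram_variation (disp_z g) f x = (2 * g x * (pd 3 f x)\<^sup>2) *\<^sub>R grad g x"
  using assms by (simp add: vec_eq_iff forall_3 gram_variation_def pd_matrix_def gram_disp_z
      matrix_vector_mult_3 inner_3 grad_nth pd_simps power2_eq_square)

section \<open>The Gibbs weight\<close>

lemma smooth_gibbs [simp, intro]: "smooth V \<Longrightarrow> smooth (gibbs Z V)"
  unfolding gibbs_def[abs_def] by (intro smooth_mult smooth_exp smooth_minus smooth_const)

lemma pd_gibbs: "smooth V \<Longrightarrow> pd i (gibbs Z V) = (\<lambda>x. - gibbs Z V x * pd i V x)"
  unfolding gibbs_def[abs_def] by (simp only: pd_simps smooth_mult smooth_exp smooth_minus smooth_const) simp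

lemma grad_log_gibbs:
  assumes "smooth V" "Z > 0"
  shows "grad_log (gibbs Z V) x = - grad V x"
proof -
  have "gibbs Z V x \<noteq> 0" using assms(2) by (simp add: gibbs_def)
  then show ?thesis
    using assms(1) by (simp add: vec_eq_iff grad_log_def grad_nth pd_gibbs)
qed

text \<open>Product rule together with \<nabla> log \<pi> = - \<nabla>V.\<close>

lemma dvg_gibbs:
  assumes "smooth V" "\<And>i. smooth (\<lambda>y. w y $ i)" "Z > 0"
  shows "1 / gibbs Z V x * dvg (\<lambda>y. gibbs Z V y *\<^sub>R w y) x = dvg w x - grad V x \<bullet> w x"
proof -
  have "gibbs Z V x \<noteq> 0" using assms(3) by (simp add: gibbs_def)
  then have "1 / gibbs Z V x * pd i (\<lambda>y. gibbs Z V y * w y $ i) x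
      = pd i (\<lambda>y. w y $ i) x - grad V x $ i * w x $ i" for i
    using assms(1,2) by (simp add: pd_mult pd_gibbs grad_nth field_simps)
  then show ?thesis
    by (simp add: dvg_def inner_vec_def sum_distrib_left sum_subtractf)
qed

section \<open>The Hessian norm and the two Gamma-2 operators\<close>

lemma disp_Q_mult:
  "disp_Q \<beta> x *v w = (let e = exp (\<beta> * x $ 1) in vector [w $ 1, e * w $ 2 + w $ 3,
     e * w $ 4 + w $ 7, e\<^sup>2 * w $ 5 + e * w $ 6 + e * w $ 8 + w $ 9])"
proof -
  have "exp (2 * \<beta> * x $ 1) = (exp (\<beta> * x $ 1))\<^sup>2"
    by (simp flip: exp_double add: mult.assoc)
  then show ?thesis
    by (simp add: vec_eq_iff forall_4 disp_Q_def Let_def matrix_vector_mult_def sum_9)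
qed

lemma disp_P_mult:
  "disp_P \<beta> g x *v w = vector [- g x * w $ 7, - g x * (exp (\<beta> * x $ 1) * w $ 8 + w $ 9)]"
  by (simp add: vec_eq_iff forall_2 disp_P_def Let_def matrix_vector_mult_def sum_9 algebra_simps)

text \<open>Rows 2 and 3 of \<open>Q\<close> give the same value by symmetry of mixed derivatives,
  hence the factor 2. The derivatives of \<open>g\<close> in \<open>disp_lambda6\<close> and
  \<open>disp_lambda9\<close> cancel.\<close>

lemma disp_Hess_sq_eq:
  assumes "smooth f"
  shows "disp_Hess_sq \<beta> g f x = (let e = exp (\<beta> * x $ 1); a2f = e * pd 2 f x + pd 3 f x;
      a12f = e * pd 1 (pd 2 f) x + pd 1 (pd 3 f) x in
    (pd 1 (pd 1 f) x)\<^sup>2 + 2 * (a12f + \<beta> * e * pd 2 f x + \<beta> * pd 3 f x / 2)\<^sup>2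
    + (e\<^sup>2 * pd 2 (pd 2 f) x + 2 * e * pd 2 (pd 3 f) x + pd 3 (pd 3 f) x - \<beta> * pd 1 f x)\<^sup>2
    + (g x * (pd 1 (pd 3 f) x - \<beta> * a2f / (g x)\<^sup>2))\<^sup>2
    + (g x * (e * pd 2 (pd 3 f) x + pd 3 (pd 3 f) x + \<beta> * pd 1 f x / (g x)\<^sup>2))\<^sup>2)"
proof -
  let ?Y1 = "disp_X f x + disp_Lambda1 \<beta> f x" and ?Y2 = "disp_X f x + disp_Lambda2 \<beta> g f x"
  let ?e = "exp (\<beta> * x $ 1)"
  have Q: "disp_Q \<beta> x *v ?Y1 = vector [pd 1 (pd 1 f) x,
      ?e * (pd 1 (pd 2 f) x + \<beta> * pd 2 f x) + (pd 1 (pd 3 f) x + \<beta> * pd 3 f x / 2),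
      ?e * (pd 1 (pd 2 f) x + \<beta> * pd 2 f x) + (pd 1 (pd 3 f) x + \<beta> * pd 3 f x / 2),
      ?e\<^sup>2 * pd 2 (pd 2 f) x + ?e * pd 2 (pd 3 f) x + ?e * pd 2 (pd 3 f) x
        + (pd 3 (pd 3 f) x - \<beta> * pd 1 f x)]"
    by (simp add: disp_Q_mult Let_def disp_X_def disp_Lambda1_def pd_commute_3 assms)
  have P: "disp_P \<beta> g x *v ?Y2 = vector [
      - g x * (pd 1 (pd 3 f) x - \<beta> * (?e * pd 2 f x + pd 3 f x) / (g x)\<^sup>2),
      - g x * (?e * pd 2 (pd 3 f) x + (pd 3 (pd 3 f) x + \<beta> * pd 1 f x / (g x)\<^sup>2))]"
    by (simp add: disp_P_mult disp_X_def disp_Lambda2_def disp_lambda6_def disp_lambda9_def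
        tgrad_disp_a pd_commute_3 assms)
  show ?thesis
    unfolding disp_Hess_sq_def Let_def inner_gram_mult P Q
    by (simp add: inner_vec_def sum_2 sum_4) algebra
qed

text \<open>Bochner formula for the fields \<open>X\<close>, \<open>Y\<close> above, with
  \<open>w = [X, Y]f\<close>. The squares are those of \<open>XXf\<close>, \<open>YXf\<close>,
  \<open>XYf = YXf + w\<close> and \<open>YYf\<close>; the two brackets are \<open>[L, X]f\<close>
  and \<open>[L, Y]f\<close>, whose second-order parts come from \<open>[YY, X]\<close> and
  \<open>[XX, Y]\<close>.\<close>

lemma Gamma2_disp_a:
  assumes "smooth V" "smooth f"
  shows "Gamma2 (disp_a \<beta>) (drift (disp_a \<beta>) V) f x =
    (let e = exp (\<beta> * x $ 1); a2f = e * pd 2 f x + pd 3 f x; a2V = e * pd 2 V x + pd 3 V x;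
       w = \<beta> * e * pd 2 f x; a12f = e * pd 1 (pd 2 f) x + pd 1 (pd 3 f) x in
     (pd 1 (pd 1 f) x)\<^sup>2 + a12f\<^sup>2 + (a12f + w)\<^sup>2
     + (e\<^sup>2 * pd 2 (pd 2 f) x + 2 * e * pd 2 (pd 3 f) x + pd 3 (pd 3 f) x)\<^sup>2
     + pd 1 f x * (pd 1 (pd 1 V) x * pd 1 f x
         + (e * pd 1 (pd 2 V) x + pd 1 (pd 3 V) x + \<beta> * e * pd 2 V x) * a2f + a2V * w
         - 2 * \<beta> * e * (e * pd 2 (pd 2 f) x + pd 2 (pd 3 f) x))
     + a2f * (\<beta> * (2 * e * pd 1 (pd 2 f) x + w) - pd 1 V x * w
         + (e * pd 1 (pd 2 V) x + pd 1 (pd 3 V) x) * pd 1 f x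
         + (e\<^sup>2 * pd 2 (pd 2 V) x + 2 * e * pd 2 (pd 3 V) x + pd 3 (pd 3 V) x) * a2f))"
  \<comment> \<open>Once mixed derivatives are sorted, the third derivatives cancel and a polynomial
    identity remains.\<close>
  using assms
  by (simp add: Gamma2_def Let_def gen_disp_a Gamma1_disp_a pd_commute_3 pd_simps) algebra

text \<open>Write \<open>h = pd 3 f\<close>. Since \<open>pd 3\<close> commutes with both fields,
  the first two terms give \<open>g^2 \<Gamma>(h,h) + 4 g h \<Gamma>(g,h) + h^2 \<Gamma>(g,g) + g
  h^2 Lg\<close> plus \<open>g^2 h [L, pd 3]f\<close>, which involves only second derivatives of
  \<open>V\<close>. The last divergence equals
  \<open>2 g h^2 Lg + 2 h^2 \<Gamma>(g,g) + 4 g h \<Gamma>(g,h)\<close> and is subtracted.\<close>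

lemma Gamma2_z_pi_disp:
  assumes "smooth g" "smooth V" "smooth f" "Z > 0"
  shows "Gamma2_z_pi (disp_a \<beta>) (disp_z g) (drift (disp_a \<beta>) V) (gibbs Z V) f x =
    (let e = exp (\<beta> * x $ 1); a2f = e * pd 2 f x + pd 3 f x; a2g = e * pd 2 g x + pd 3 g x in
     (g x)\<^sup>2 * ((pd 1 (pd 3 f) x)\<^sup>2 + (e * pd 2 (pd 3 f) x + pd 3 (pd 3 f) x)\<^sup>2)
     - (pd 3 f x)\<^sup>2 * ((pd 1 g x)\<^sup>2 + a2g\<^sup>2)
     - g x * (pd 3 f x)\<^sup>2 * gen (disp_a \<beta>) (drift (disp_a \<beta>) V) g x
     + (g x)\<^sup>2 * pd 3 f x * (pd 1 (pd 3 V) x * pd 1 f x + (e * pd 2 (pd 3 V) x + pd 3 (pd 3 V) x) * a2f))"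
proof -
  let ?u = "\<lambda>y. gram (disp_z g) y *v gram_variation (disp_a \<beta>) f y"
  let ?w = "\<lambda>y. gram (disp_a \<beta>) y *v gram_variation (disp_z g) f y"
  have w: "?w y = vector [2 * g y * (pd 3 f y)\<^sup>2 * pd 1 g y,
      2 * g y * (pd 3 f y)\<^sup>2 * (exp (\<beta> * y $ 1) * (exp (\<beta> * y $ 1) * pd 2 g y + pd 3 g y)),
      2 * g y * (pd 3 f y)\<^sup>2 * (exp (\<beta> * y $ 1) * pd 2 g y + pd 3 g y)]" for y
    by (simp add: gram_disp_a gram_variation_disp_z assms matrix_vector_mult_3 grad_nth
        power2_eq_square algebra_simps)
  have smooth_w: "smooth (\<lambda>y. ?w y $ i)" for i
    using exhaust_3[of i] unfolding w by (auto simp: assms)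
  have "?u = (\<lambda>y. 0)"
    by (rule ext) (simp add: vec_eq_iff forall_3 gram_disp_z gram_variation_disp_a matrix_vector_mult_3)
  then have u: "dvg (\<lambda>y. gibbs Z V y *\<^sub>R ?u y) x = 0"
    by (simp add: dvg_def pd_const fun_eq_iff)
  show ?thesis
    \<comment> \<open>The weight is removed while the field is still a scalar multiple of
      \<open>gibbs Z V\<close>; only then is it written in components.\<close>
    unfolding Gamma2_z_pi_def u dvg_gibbs[of V ?w, OF assms(2) smooth_w assms(4)]
    unfolding w
    using assms
    by (simp add: Let_def dvg_def sum_3 inner_3 grad_nth gen_disp_a Gamma1_disp_z
        pd_commute_3 pd_simps) algebra
qed

theorem proposition3p10:
  fixes \<beta> Z :: real and g V f :: "real^3 \<Rightarrow> real" and x :: "real^3"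
  assumes "\<beta> \<ge> 0" and "\<beta> \<noteq> 0"
    and "smooth g" and "\<And>y. g y \<noteq> 0"
    and "smooth V"
    and "Z > 0"
    and "smooth f"
  shows "Gamma2 (disp_a \<beta>) (drift (disp_a \<beta>) V) f x
         + Gamma2_z_pi (disp_a \<beta>) (disp_z g) (drift (disp_a \<beta>) V) (gibbs Z V) f x
       = disp_Hess_sq \<beta> g f x + disp_R \<beta> g V (gibbs Z V) f x"
proof -
  have exp2: "exp (2 * \<beta> * x $ 1) = (exp (\<beta> * x $ 1))\<^sup>2"
    by (simp flip: exp_double add: mult.assoc)
  have g: "g x \<noteq> 0" by fact
  \<comment> \<open>Cross terms here are free of \<open>g\<close>. Together with those of
    \<open>disp_Lambda1\<close> they leave exactly the linear Hessian terms of
    \<open>Gamma2\<close>; the remainders \<open>b^2 / g^2\<close> cancel the \<open>1 / g^2\<close>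
    part of \<open>- \<beta>^2 (1 + 1 / g^2) \<Gamma>(f,f)\<close>.\<close>
  have square: "(g x * (p + b / (g x)\<^sup>2))\<^sup>2 = (g x)\<^sup>2 * p\<^sup>2 + 2 * b * p + b\<^sup>2 * (1 / (g x)\<^sup>2)"
    "(g x * (p - b / (g x)\<^sup>2))\<^sup>2 = (g x)\<^sup>2 * p\<^sup>2 - 2 * b * p + b\<^sup>2 * (1 / (g x)\<^sup>2)" for p b
    using g by (simp_all add: field_simps power2_eq_square)
  \<comment> \<open>An opaque name keeps the remaining \<open>1 / g^2\<close> from being multiplied
    out by \<open>field_simps\<close>.\<close>
  define q where "q = 1 / (g x)\<^sup>2"
  \<comment> \<open>Each logarithmic gradient of \<open>g\<close> costs one factor
    \<open>1 / g\<close>, paid by the \<open>g^2\<close> from the \<open>z\<close> direction; in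
    \<open>log_pi\<close> one factor \<open>g\<close> is left over.\<close>
  have log_g: "Gamma_form (disp_a \<beta>) x (grad_log g x) (grad_log g x) * ((g x)\<^sup>2 * c)
      = Gamma1 (disp_a \<beta>) g g x * c" for c
    using g by (simp add: Gamma1_def Gamma_form_disp_a grad_log_def field_simps power2_eq_square)
  have log_pi: "Gamma_form (disp_a \<beta>) x (grad_log (gibbs Z V) x) (grad_log g x) * ((g x)\<^sup>2 * c)
      = - Gamma1 (disp_a \<beta>) V g x * g x * c" for c
    unfolding grad_log_gibbs[OF assms(5,6)]
    using g by (simp add: Gamma1_def Gamma_form_disp_a grad_log_def field_simps power2_eq_square)
  have z1f: "\<bar>- g x * c\<bar>\<^sup>2 = (g x)\<^sup>2 * c\<^sup>2" for c
    by (simp add: power_mult_distrib)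
  have cancel: "b / (2 * (g x)\<^sup>2) * ((g x)\<^sup>2 * c) = b * c / 2" "(g x)\<^sup>2 * c / g x = g x * c" for b c
    using g by (simp_all add: power2_eq_square)
  \<comment> \<open>The instances of associativity expose products of the form
    \<open>_ * ((g x)^2 * c)\<close>, to which \<open>log_g\<close>, \<open>log_pi\<close> and
    \<open>cancel\<close> apply.\<close>
  show ?thesis
    unfolding Gamma2_disp_a[OF assms(5,7)] Gamma2_z_pi_disp[OF assms(3,5,7,6)]
      disp_Hess_sq_eq[OF assms(7)] disp_R_def disp_R1_def disp_R2_def disp_R3_def Let_def exp2
      gen_disp_a[OF assms(5,3)] square Gamma1_disp_z tgrad_disp_z z1f mult.assoc[of "(g x)\<^sup>2"]
      mult.assoc[of "- 2" "Gamma_form _ _ _ _"] mult.assoc[of 2 "Gamma_form _ _ _ _"]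
      log_g log_pi cancel
    unfolding Gamma1_disp_a tgrad_disp_a sum_2 power2_abs q_def[symmetric]
    by (simp add: field_simps power2_eq_square)
qed

end
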